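(* Let $G$ be a simple connected graph with $n$ vertices and $m$ edges, let $k\ge1$ be an integer, and let $S_{2k}(G)$ be the $2k$-parallel subdivision graph of $G$. If $\zeta\notin\{\frac12,\frac32\}$ is an eigenvalue of $\mathscr{L}(S_{2k}(G))$, then $\zeta(4\zeta^2-12\zeta+9)$ is an eigenvalue of $\mathscr{L}(G)$, and its multiplicity is the same as that of $\zeta$.
   Context: For a graph $H$ with adjacency matrix $A(H)$ and diagonal degree matrix $D(H)$ (no isolated vertices), the normalized Laplacian is $\mathscr{L}(H)=I-D(H)^{-1/2}A(H)D(H)^{-1/2}$. The $2k$-parallel subdivision graph $S_{2k}(G)$ is obtained from $G$ by replacing each edge $uv$ of $G$ by $k$ internally disjoint paths $u-w_1-w_2-v$ of length $3$ (each with its own two new internal vertices). *)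

theory Defs
  imports Main "Jordan_Normal_Form.Char_Poly"
begin

text \<open>A graph is given by a vertex set V and a set E of edges, each edge being a
  two-element set of vertices.\<close>

definition simple_graph :: "'a set \<Rightarrow> 'a set set \<Rightarrow> bool" where
  "simple_graph V E \<longleftrightarrow> finite V \<and>
     (\<forall>e\<in>E. \<exists>u v. e = {u, v} \<and> u \<noteq> v \<and> u \<in> V \<and> v \<in> V)"

definition connected_graph :: "'a set \<Rightarrow> 'a set set \<Rightarrow> bool" where
  "connected_graph V E \<longleftrightarrow> V \<noteq> {} \<and>
     (\<forall>u\<in>V. \<forall>v\<in>V. (u, v) \<in> {(x, y). {x, y} \<in> E}\<^sup>*)"

definition no_isolated_vertices :: "'a set \<Rightarrow> 'a set set \<Rightarrow> bool" where
  "no_isolated_vertices V E \<longleftrightarrow> (\<forall>v\<in>V. \<exists>e\<in>E. v \<in> e)"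

definition degree :: "'a set \<Rightarrow> 'a set set \<Rightarrow> 'a \<Rightarrow> nat" where
  "degree V E u = card {v \<in> V. {u, v} \<in> E}"

text \<open>Entries of the normalized Laplacian  I - D^(-1/2) A D^(-1/2).\<close>
definition nlap_entry :: "'a set \<Rightarrow> 'a set set \<Rightarrow> 'a \<Rightarrow> 'a \<Rightarrow> real" where
  "nlap_entry V E u v =
     (if u = v then 1 else 0)
     - (if {u, v} \<in> E then 1 / sqrt (real (degree V E u) * real (degree V E v)) else 0)"

text \<open>A fixed enumeration of the (finite) vertex set; the spectrum does not depend on it.\<close>
definition vertex_list :: "'a set \<Rightarrow> 'a list" where
  "vertex_list V = (SOME xs. distinct xs \<and> set xs = V)"

definition nlap :: "'a set \<Rightarrow> 'a set set \<Rightarrow> real mat" where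
  "nlap V E = (let xs = vertex_list V in
     mat (length xs) (length xs) (\<lambda>(i, j). nlap_entry V E (xs ! i) (xs ! j)))"

text \<open>The 2k-parallel subdivision graph. Original vertices are Inl u; for each edge {u,v}
  and each i < k, the path number i is  u - Inr (u,v,i) - Inr (v,u,i) - v.\<close>
definition subdiv_vertices :: "'a set \<Rightarrow> 'a set set \<Rightarrow> nat \<Rightarrow> ('a + 'a \<times> 'a \<times> nat) set" where
  "subdiv_vertices V E k =
     Inl ` V \<union> {Inr (u, v, i) | u v i. {u, v} \<in> E \<and> i < k}"

definition subdiv_edges :: "'a set \<Rightarrow> 'a set set \<Rightarrow> nat \<Rightarrow> ('a + 'a \<times> 'a \<times> nat) set set" where
  "subdiv_edges V E k =
     {{Inl u, Inr (u, v, i)} | u v i. {u, v} \<in> E \<and> i < k}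
     \<union> {{Inr (u, v, i), Inr (v, u, i)} | u v i. {u, v} \<in> E \<and> i < k}"

end

theory Submission
  imports Defs
    "Jordan_Normal_Form.Jordan_Normal_Form_Uniqueness"
    "Jordan_Normal_Form.Jordan_Normal_Form_Existence"
begin

text \<open>Write \<open>\<mu> = 1 - \<zeta>\<close>. On each path \<open>u - w\<^sub>1 - w\<^sub>2 - v\<close> of \<open>S\<^sub>2\<^sub>k(G)\<close> the eigenvalue
  equations at \<open>w\<^sub>1\<close> and \<open>w\<^sub>2\<close> form a \<open>2 \<times> 2\<close> system whose determinant vanishes only for
  \<open>4\<mu>\<^sup>2 = 1\<close>, i.e. \<open>\<zeta> \<in> {1/2, 3/2}\<close>; so an eigenvector is determined by its values on the
  original vertices. Substituting the solution into the equation at an original vertex yields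
  the eigenvalue equation of \<open>\<L>(G)\<close> for \<open>1 - (4\<mu>\<^sup>3 - 3\<mu>) = \<zeta>(2\<zeta> - 3)\<^sup>2\<close>, and conversely every
  eigenvector of \<open>\<L>(G)\<close> extends this way. Hence restriction to the original vertices is a linear
  isomorphism of eigenspaces, and as both matrices are symmetric, geometric and algebraic
  multiplicities agree.\<close>

hide_const (open) Coset.order

lemma hermitian_cscalar_prod_swap:
  fixes M :: "complex mat"
  assumes M: "M \<in> carrier_mat n n"
    and herm: "\<And>i j. i < n \<Longrightarrow> j < n \<Longrightarrow> M $$ (i, j) = conjugate (M $$ (j, i))"
    and v: "v \<in> carrier_vec n" and w: "w \<in> carrier_vec n"
  shows "(M *\<^sub>v v) \<bullet>c w = v \<bullet>c (M *\<^sub>v w)"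
proof -
  have herm': "conjugate (M $$ (j, i)) = M $$ (i, j)" if "i < n" "j < n" for i j
    using herm[OF that] by simp
  have "(M *\<^sub>v v) \<bullet>c w = (\<Sum>i<n. (\<Sum>j<n. M $$ (i, j) * v $ j) * conjugate (w $ i))"
    using M v w by (simp add: scalar_prod_def mult_mat_vec_def lessThan_atLeast0 row_def)
  also have "\<dots> = (\<Sum>i<n. \<Sum>j<n. v $ j * (M $$ (i, j) * conjugate (w $ i)))"
    by (simp only: sum_distrib_right) (simp add: mult_ac)
  also have "\<dots> = (\<Sum>j<n. \<Sum>i<n. v $ j * (M $$ (i, j) * conjugate (w $ i)))"
    by (rule sum.swap)
  also have "\<dots> = (\<Sum>j<n. v $ j * conjugate (\<Sum>i<n. M $$ (j, i) * w $ i))"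
    using herm' by (auto simp: sum_distrib_left intro!: sum.cong)
  also have "\<dots> = v \<bullet>c (M *\<^sub>v w)"
    using M v w by (simp add: scalar_prod_def mult_mat_vec_def lessThan_atLeast0 row_def)
  finally show ?thesis .
qed

lemma hermitian_mat_kernel_square:
  fixes M :: "complex mat"
  assumes M: "M \<in> carrier_mat n n"
    and herm: "\<And>i j. i < n \<Longrightarrow> j < n \<Longrightarrow> M $$ (i, j) = conjugate (M $$ (j, i))"
  shows "mat_kernel (M * M) = mat_kernel M"
proof
  show "mat_kernel M \<subseteq> mat_kernel (M * M)"
    using M by (auto simp: mat_kernel_def assoc_mult_mat_vec[symmetric])
  show "mat_kernel (M * M) \<subseteq> mat_kernel M"
  proof
    fix v assume "v \<in> mat_kernel (M * M)"
    hence v: "v \<in> carrier_vec n" and MMv: "M *\<^sub>v (M *\<^sub>v v) = 0\<^sub>v n"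
      using M by (auto simp: mat_kernel_def assoc_mult_mat_vec)
    have Mv: "M *\<^sub>v v \<in> carrier_vec n" using M v by auto
    have "(M *\<^sub>v v) \<bullet>c (M *\<^sub>v v) = v \<bullet>c (M *\<^sub>v (M *\<^sub>v v))"
      by (rule hermitian_cscalar_prod_swap[OF M herm v Mv])
    also have "\<dots> = 0" unfolding MMv using v by simp
    finally have "M *\<^sub>v v = 0\<^sub>v n" using conjugate_square_eq_0_vec[OF Mv] by simp
    thus "v \<in> mat_kernel M" using v M by (auto simp: mat_kernel_def)
  qed
qed

lemma sum_list_min_2_eq_min_1_imp_eq:
  fixes xs :: "nat list"
  assumes "sum_list (map (min 2) xs) = sum_list (map (min 1) xs)"
  shows "sum_list xs = sum_list (map (min 1) xs)"
  using assms
proof (induction xs)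
  case (Cons x xs)
  have "sum_list (map (min 1) xs) \<le> sum_list (map (min 2) xs)"
    by (induction xs) auto
  with Cons.prems have "min 2 x = min 1 x"
    and "sum_list (map (min 2) xs) = sum_list (map (min 1) xs)"
    by auto
  with Cons.IH show ?case by auto
qed simp

text \<open>Since \<open>ker M\<^sup>2 = ker M\<close> for the Hermitian matrix \<open>M = A - cI\<close>, all Jordan blocks of \<open>A\<close>
  for \<open>c\<close> have size 1.\<close>
lemma order_char_poly_hermitian:
  fixes A :: "complex mat"
  assumes A: "A \<in> carrier_mat n n"
    and herm: "\<And>i j. i < n \<Longrightarrow> j < n \<Longrightarrow> A $$ (i, j) = conjugate (A $$ (j, i))"
    and real: "conjugate c = c"
  shows "order c (char_poly A) = kernel_dim (char_matrix A c)"
proof -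
  define M where "M = char_matrix A c"
  have M: "M \<in> carrier_mat n n" using A unfolding M_def by auto
  have herm_M: "M $$ (i, j) = conjugate (M $$ (j, i))" if "i < n" "j < n" for i j
    using that A herm[OF that] real unfolding M_def char_matrix_def by auto
  obtain as where "char_poly A = (\<Prod>a\<leftarrow>as. [:- a, 1:])"
    using char_poly_factorized[OF A] by auto
  from jordan_nf_exists[OF A this] obtain n_as where jnf: "jordan_nf A n_as" ..
  define sizes where "sizes = map fst (filter (\<lambda>(_, e). e = c) n_as)"
  have dim1: "dim_gen_eigenspace A c 1 = kernel_dim M"
    using M unfolding dim_gen_eigenspace_def M_def[symmetric] by simp
  have "dim_gen_eigenspace A c 2 = kernel_dim M"
    using M hermitian_mat_kernel_square[OF M herm_M]
    unfolding dim_gen_eigenspace_def M_def[symmetric] kernel_dim_def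
    by (simp add: numeral_2_eq_2)
  with dim1 have "sum_list (map (min 2) sizes) = sum_list (map (min 1) sizes)"
    using dim_gen_eigenspace[OF jnf, of c 1] dim_gen_eigenspace[OF jnf, of c 2]
    unfolding sizes_def by (simp add: sum_list_sum_nth)
  hence "sum_list sizes = sum_list (map (min 1) sizes)"
    by (rule sum_list_min_2_eq_min_1_imp_eq)
  moreover have "order c (char_poly A) = sum_list sizes"
    unfolding jordan_nf_order[OF jnf] sizes_def by (induction n_as) auto
  ultimately show ?thesis
    using dim_gen_eigenspace[OF jnf, of c 1] dim1 unfolding sizes_def M_def
    by (simp add: sum_list_sum_nth)
qed

lemma eigenvalue_iff_order_char_poly:
  fixes A :: "'a::field mat"
  assumes "A \<in> carrier_mat n n"
  shows "eigenvalue A c \<longleftrightarrow> order c (char_poly A) \<noteq> 0"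
proof -
  have "char_poly A \<noteq> 0" using degree_monic_char_poly[OF assms] by auto
  thus ?thesis using eigenvalue_root_char_poly[OF assms] order_root by blast
qed

lemma kernel_dim_eq_if_bij_betw:
  fixes A1 :: "'a::field mat"
  assumes A1: "A1 \<in> carrier_mat r1 c1" and A2: "A2 \<in> carrier_mat r2 c2"
    and R: "R \<in> carrier_mat c2 c1"
    and bij: "bij_betw ((*\<^sub>v) R) (mat_kernel A1) (mat_kernel A2)"
  shows "kernel_dim A1 = kernel_dim A2"
proof -
  interpret K1: kernel r1 c1 A1 by (unfold_locales, rule A1)
  interpret K2: kernel r2 c2 A2 by (unfold_locales, rule A2)
  have maps: "R *\<^sub>v v \<in> mat_kernel A2" if "v \<in> mat_kernel A1" for v
    using bij that by (auto simp: bij_betw_def)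
  have car: "v \<in> carrier_vec c1" if "v \<in> mat_kernel A1" for v
    using that A1 by (auto simp: mat_kernel_def)
  interpret R: linear_map class_ring K1.VK K2.VK "(*\<^sub>v) R"
  proof (intro linear_map.intro mod_hom.intro)
    show "mod_hom_axioms class_ring K1.VK K2.VK ((*\<^sub>v) R)"
      unfolding mod_hom_axioms_def module_hom_def
      using maps car R by (auto simp: mult_add_distrib_mat_vec mult_mat_vec)
  qed (rule K1.Ker.vectorspace_axioms K2.Ker.vectorspace_axioms
      K1.Ker.module_axioms K2.Ker.module_axioms)+
  obtain B where "finite B" "K1.basis B" using kernel_basis_exists[OF A1] by auto
  hence "K1.Ker.fin_dim" unfolding K1.Ker.fin_dim_def K1.Ker.basis_def by auto
  hence "K1.dim = K2.dim"
    using bij by (intro R.dim_eq) (auto simp: bij_betw_def)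
  thus ?thesis using A1 A2 by (simp add: kernel_dim_def)
qed

lemma find_index_nth: "distinct xs \<Longrightarrow> i < length xs \<Longrightarrow> find_index xs (xs ! i) = i"
  by (induction xs arbitrary: i) (auto simp: nth_Cons split: nat.split)

lemma
  assumes "finite W"
  shows distinct_vertex_list: "distinct (vertex_list W)"
    and set_vertex_list: "set (vertex_list W) = W"
    and length_vertex_list: "length (vertex_list W) = card W"
proof -
  have "\<exists>xs. distinct xs \<and> set xs = W"
    using finite_distinct_list[OF assms] by blast
  hence "distinct (vertex_list W) \<and> set (vertex_list W) = W"
    unfolding vertex_list_def by (rule someI_ex)
  thus "distinct (vertex_list W)" "set (vertex_list W) = W" "length (vertex_list W) = card W"
    using distinct_card by fastforce+
qed

lemma nlap_carrier_mat: "finite W \<Longrightarrow> nlap W F \<in> carrier_mat (card W) (card W)"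
  by (simp add: nlap_def Let_def length_vertex_list)

lemma index_nlap:
  "finite W \<Longrightarrow> i < card W \<Longrightarrow> j < card W \<Longrightarrow>
    nlap W F $$ (i, j) = nlap_entry W F (vertex_list W ! i) (vertex_list W ! j)"
  by (simp add: nlap_def Let_def length_vertex_list)

lemma nlap_entry_commute: "nlap_entry W F x y = nlap_entry W F y x"
  unfolding nlap_entry_def by (auto simp: insert_commute mult.commute)

lemma nlap_entry_sum:
  fixes f :: "'v \<Rightarrow> complex"
  assumes "finite W" and "x \<in> W" and "{x, x} \<notin> F"
  shows "(\<Sum>y\<in>W. of_real (nlap_entry W F x y) * f y) = f x -
    (\<Sum>y\<in>{y\<in>W. {x, y} \<in> F}. f y / of_real (sqrt (real (Defs.degree W F x) * real (Defs.degree W F y))))"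
proof -
  have "(\<Sum>y\<in>W. of_real (nlap_entry W F x y) * f y) = (\<Sum>y\<in>W. if x = y then f y else 0) -
    (\<Sum>y\<in>W. if {x, y} \<in> F then f y / of_real (sqrt (real (Defs.degree W F x) * real (Defs.degree W F y))) else 0)"
    unfolding sum_subtractf[symmetric] nlap_entry_def using assms(3)
    by (intro sum.cong refl) (auto simp: divide_inverse of_real_inverse algebra_simps)
  thus ?thesis using assms(1,2) by (simp add: sum.inter_filter)
qed

definition vertex_fun :: "'v set \<Rightarrow> 'b vec \<Rightarrow> 'v \<Rightarrow> 'b" where
  "vertex_fun W v y = v $ find_index (vertex_list W) y"

lemma vertex_fun_nth: "finite W \<Longrightarrow> j < card W \<Longrightarrow> vertex_fun W v (vertex_list W ! j) = v $ j"
  by (simp add: vertex_fun_def find_index_nth distinct_vertex_list length_vertex_list)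

lemma find_index_vertex_list:
  assumes "finite W" and "y \<in> W"
  shows "find_index (vertex_list W) y < card W" and "vertex_list W ! find_index (vertex_list W) y = y"
  using assms find_index_leq_length find_index_in_set
  by (metis length_vertex_list set_vertex_list)+

lemma vertex_fun_vec:
  "finite W \<Longrightarrow> y \<in> W \<Longrightarrow> vertex_fun W (vec (card W) (\<lambda>j. f (vertex_list W ! j))) y = f y"
  by (simp add: vertex_fun_def find_index_vertex_list)

lemma vec_eq_iff_vertex_fun:
  assumes "finite W" and "v \<in> carrier_vec (card W)" and "w \<in> carrier_vec (card W)"
  shows "v = w \<longleftrightarrow> (\<forall>y\<in>W. vertex_fun W v y = vertex_fun W w y)"
proof
  assume "\<forall>y\<in>W. vertex_fun W v y = vertex_fun W w y"
  hence "v $ j = w $ j" if "j < card W" for j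
    using that assms(1) vertex_fun_nth[OF assms(1)] nth_mem[of j "vertex_list W"]
    by (metis length_vertex_list set_vertex_list)
  thus "v = w" using assms(2,3) by (intro eq_vecI) auto
qed simp

definition eigenfunction :: "'v set \<Rightarrow> 'v set set \<Rightarrow> complex \<Rightarrow> ('v \<Rightarrow> complex) \<Rightarrow> bool" where
  "eigenfunction W F z f \<longleftrightarrow> (\<forall>x\<in>W. (\<Sum>y\<in>W. of_real (nlap_entry W F x y) * f y) = z * f x)"

lemma eigenfunction_cong:
  "(\<And>y. y \<in> W \<Longrightarrow> f y = g y) \<Longrightarrow> eigenfunction W F z f \<longleftrightarrow> eigenfunction W F z g"
  unfolding eigenfunction_def by simp

lemma vertex_fun_nlap_mult_vec:
  assumes W: "finite W" and v: "v \<in> carrier_vec (card W)" and x: "x \<in> W"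
  shows "vertex_fun W (map_mat of_real (nlap W F) *\<^sub>v v) x =
    (\<Sum>y\<in>W. of_real (nlap_entry W F x y) * vertex_fun W v y)"
proof -
  let ?xs = "vertex_list W"
  have L: "dim_row (nlap W F) = card W" "dim_col (nlap W F) = card W"
    using nlap_carrier_mat[OF W] by auto
  have "vertex_fun W (map_mat of_real (nlap W F) *\<^sub>v v) x =
      (\<Sum>j<card W. of_real (nlap_entry W F x (?xs ! j)) * v $ j)"
    using v find_index_vertex_list[OF W x]
    by (simp add: vertex_fun_def L index_nlap[OF W] mult_mat_vec_def scalar_prod_def
        lessThan_atLeast0 row_def)
  also have "\<dots> = (\<Sum>j<card W. of_real (nlap_entry W F x (?xs ! j)) * vertex_fun W v (?xs ! j))"
    by (simp add: vertex_fun_nth[OF W])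
  also have "\<dots> = (\<Sum>y\<in>W. of_real (nlap_entry W F x y) * vertex_fun W v y)"
    using sum.reindex_bij_betw[OF bij_betw_nth[OF distinct_vertex_list[OF W] refl refl]]
    by (simp add: length_vertex_list[OF W] set_vertex_list[OF W] lessThan_atLeast0)
  finally show ?thesis .
qed

lemma mat_kernel_char_matrix_nlap_iff:
  assumes W: "finite W" and v: "v \<in> carrier_vec (card W)"
  shows "v \<in> mat_kernel (char_matrix (map_mat of_real (nlap W F)) z) \<longleftrightarrow>
    eigenfunction W F z (vertex_fun W v)"
proof -
  let ?L = "map_mat complex_of_real (nlap W F)"
  have L: "?L \<in> carrier_mat (card W) (card W)" using nlap_carrier_mat[OF W] by simp
  have "char_matrix ?L z *\<^sub>v v = ?L *\<^sub>v v + ((- z) \<cdot>\<^sub>m 1\<^sub>m (card W)) *\<^sub>v v"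
    unfolding char_matrix_def using L v by (simp add: add_mult_distrib_mat_vec)
  hence "(char_matrix ?L z *\<^sub>v v) $ i = (?L *\<^sub>v v) $ i - z * v $ i" if "i < card W" for i
    using that L v by simp
  moreover have "char_matrix ?L z \<in> carrier_mat (card W) (card W)" using L by simp
  ultimately have "v \<in> mat_kernel (char_matrix ?L z) \<longleftrightarrow> (\<forall>i<card W. (?L *\<^sub>v v) $ i = z * v $ i)"
    unfolding mat_kernel_def using v by (auto simp: vec_eq_iff)
  also have "\<dots> \<longleftrightarrow> ?L *\<^sub>v v = z \<cdot>\<^sub>v v"
    using L v by (auto simp: vec_eq_iff)
  also have "\<dots> \<longleftrightarrow> eigenfunction W F z (vertex_fun W v)"
    using L v find_index_vertex_list[OF W]
    by (simp add: vec_eq_iff_vertex_fun[OF W] vertex_fun_nlap_mult_vec[OF W v] eigenfunction_def)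
      (simp add: vertex_fun_def)
  finally show ?thesis .
qed

lemma order_char_poly_nlap:
  assumes W: "finite W"
  shows "order \<zeta> (char_poly (nlap W F)) =
    kernel_dim (char_matrix (map_mat complex_of_real (nlap W F)) (of_real \<zeta>))"
proof -
  interpret m: map_poly_inj_idom_divide_hom complex_of_real ..
  have L: "nlap W F \<in> carrier_mat (card W) (card W)" by (rule nlap_carrier_mat[OF W])
  have "order \<zeta> (char_poly (nlap W F)) =
      order (of_real \<zeta>) (char_poly (map_mat complex_of_real (nlap W F)))"
    unfolding of_real_hom.char_poly_hom[OF L] m.order_hom ..
  also have "\<dots> = kernel_dim (char_matrix (map_mat complex_of_real (nlap W F)) (of_real \<zeta>))"
    using L by (intro order_char_poly_hermitian[where n = "card W"])
      (auto simp: index_nlap[OF W] nlap_entry_commute)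
  finally show ?thesis .
qed

definition restrict_mat :: "'v set \<Rightarrow> 'w set \<Rightarrow> ('w \<Rightarrow> 'v) \<Rightarrow> 'b::zero_neq_one mat" where
  "restrict_mat W1 W2 \<iota> = mat (card W2) (card W1) (\<lambda>(i, j).
     of_bool (j = find_index (vertex_list W1) (\<iota> (vertex_list W2 ! i))))"

lemma restrict_mat_carrier: "restrict_mat W1 W2 \<iota> \<in> carrier_mat (card W2) (card W1)"
  by (simp add: restrict_mat_def)

lemma vertex_fun_restrict_mat_mult_vec:
  fixes v :: "'b::comm_ring_1 vec"
  assumes W1: "finite W1" and W2: "finite W2" and \<iota>: "\<iota> ` W2 \<subseteq> W1"
    and v: "v \<in> carrier_vec (card W1)" and u: "u \<in> W2"
  shows "vertex_fun W2 (restrict_mat W1 W2 \<iota> *\<^sub>v v) u = vertex_fun W1 v (\<iota> u)"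
proof -
  have "find_index (vertex_list W1) (\<iota> u) < card W1"
    using find_index_vertex_list[OF W1] \<iota> u by blast
  thus ?thesis
    using v find_index_vertex_list[OF W2 u]
    by (simp add: restrict_mat_def vertex_fun_def mult_mat_vec_def scalar_prod_def row_def)
qed

lemma bij_betw_restrict_mat_eigenspaces:
  fixes \<iota> :: "'w \<Rightarrow> 'v"
  assumes W1: "finite W1" and W2: "finite W2" and \<iota>: "\<iota> ` W2 \<subseteq> W1"
    and restrict: "\<And>f. eigenfunction W1 F1 z1 f \<Longrightarrow> eigenfunction W2 F2 z2 (f \<circ> \<iota>)"
    and determined: "\<And>f g x. eigenfunction W1 F1 z1 f \<Longrightarrow> eigenfunction W1 F1 z1 g \<Longrightarrow>
      (\<And>u. u \<in> W2 \<Longrightarrow> f (\<iota> u) = g (\<iota> u)) \<Longrightarrow> x \<in> W1 \<Longrightarrow> f x = g x"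
    and extend: "\<And>h. eigenfunction W2 F2 z2 h \<Longrightarrow>
      \<exists>f. eigenfunction W1 F1 z1 f \<and> (\<forall>u\<in>W2. f (\<iota> u) = h u)"
  shows "bij_betw ((*\<^sub>v) (restrict_mat W1 W2 \<iota>))
    (mat_kernel (char_matrix (map_mat of_real (nlap W1 F1)) z1))
    (mat_kernel (char_matrix (map_mat of_real (nlap W2 F2)) z2))"
proof -
  let ?K1 = "mat_kernel (char_matrix (map_mat of_real (nlap W1 F1)) z1)"
  let ?K2 = "mat_kernel (char_matrix (map_mat of_real (nlap W2 F2)) z2)"
  let ?R = "restrict_mat W1 W2 \<iota> :: complex mat"
  have "char_matrix (map_mat complex_of_real (nlap W1 F1)) z1 \<in> carrier_mat (card W1) (card W1)"
    using nlap_carrier_mat[OF W1] by simp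
  hence car1: "v \<in> carrier_vec (card W1)" if "v \<in> ?K1" for v
    using that by (auto simp: mat_kernel_def)
  have K1: "v \<in> ?K1 \<longleftrightarrow> eigenfunction W1 F1 z1 (vertex_fun W1 v)"
    if "v \<in> carrier_vec (card W1)" for v
    by (rule mat_kernel_char_matrix_nlap_iff[OF W1 that])
  have "char_matrix (map_mat complex_of_real (nlap W2 F2)) z2 \<in> carrier_mat (card W2) (card W2)"
    using nlap_carrier_mat[OF W2] by simp
  hence car2: "w \<in> carrier_vec (card W2)" if "w \<in> ?K2" for w
    using that by (auto simp: mat_kernel_def)
  have K2: "w \<in> ?K2 \<longleftrightarrow> eigenfunction W2 F2 z2 (vertex_fun W2 w)"
    if "w \<in> carrier_vec (card W2)" for w
    by (rule mat_kernel_char_matrix_nlap_iff[OF W2 that])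
  note R_restricts = vertex_fun_restrict_mat_mult_vec[OF W1 W2 \<iota>]
  show ?thesis
  proof (intro bij_betwI')
    fix v assume v: "v \<in> ?K1"
    have "eigenfunction W2 F2 z2 (vertex_fun W1 v \<circ> \<iota>)"
      using K1[OF car1[OF v]] v restrict by blast
    hence "eigenfunction W2 F2 z2 (vertex_fun W2 (?R *\<^sub>v v))"
      using eigenfunction_cong[of W2 "vertex_fun W2 (?R *\<^sub>v v)" "vertex_fun W1 v \<circ> \<iota>"]
        R_restricts[OF car1[OF v]]
      by simp
    thus "?R *\<^sub>v v \<in> ?K2"
      using K2[OF mult_mat_vec_carrier[OF restrict_mat_carrier car1[OF v]]] by blast
  next
    fix v w assume v: "v \<in> ?K1" and w: "w \<in> ?K1"
    show "?R *\<^sub>v v = ?R *\<^sub>v w \<longleftrightarrow> v = w"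
    proof
      assume Rvw: "?R *\<^sub>v v = ?R *\<^sub>v w"
      have "vertex_fun W1 v x = vertex_fun W1 w x" if "x \<in> W1" for x
      proof (rule determined[OF _ _ _ that])
        show "eigenfunction W1 F1 z1 (vertex_fun W1 v)" "eigenfunction W1 F1 z1 (vertex_fun W1 w)"
          using K1[OF car1[OF v]] K1[OF car1[OF w]] v w by blast+
        show "vertex_fun W1 v (\<iota> u) = vertex_fun W1 w (\<iota> u)" if "u \<in> W2" for u
          using R_restricts[OF car1[OF v] that] R_restricts[OF car1[OF w] that] Rvw by simp
      qed
      thus "v = w" using vec_eq_iff_vertex_fun[OF W1 car1[OF v] car1[OF w]] by blast
    qed simp
  next
    fix w assume w: "w \<in> ?K2"
    obtain f where f: "eigenfunction W1 F1 z1 f" and f_\<iota>: "\<forall>u\<in>W2. f (\<iota> u) = vertex_fun W2 w u"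
      using extend[of "vertex_fun W2 w"] K2[OF car2[OF w]] w by blast
    define v where "v = vec (card W1) (\<lambda>j. f (vertex_list W1 ! j))"
    have v: "v \<in> carrier_vec (card W1)" unfolding v_def by simp
    have fv: "vertex_fun W1 v x = f x" if "x \<in> W1" for x
      unfolding v_def by (rule vertex_fun_vec[OF W1 that])
    have "v \<in> ?K1"
      using K1[OF v] f eigenfunction_cong[of W1 "vertex_fun W1 v" f, OF fv] by blast
    moreover have "w = ?R *\<^sub>v v"
      using R_restricts[OF v] fv \<iota> f_\<iota>
      by (subst vec_eq_iff_vertex_fun[OF W2 car2[OF w] mult_mat_vec_carrier[OF restrict_mat_carrier v]])
        auto
    ultimately show "\<exists>v\<in>?K1. w = ?R *\<^sub>v v" by blast
  qed
qed

lemma kernel_dim_nlap_eq_if_eigenfunctions_correspond: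
  fixes \<iota> :: "'w \<Rightarrow> 'v"
  assumes W1: "finite W1" and W2: "finite W2" and \<iota>: "\<iota> ` W2 \<subseteq> W1"
    and restrict: "\<And>f. eigenfunction W1 F1 z1 f \<Longrightarrow> eigenfunction W2 F2 z2 (f \<circ> \<iota>)"
    and determined: "\<And>f g x. eigenfunction W1 F1 z1 f \<Longrightarrow> eigenfunction W1 F1 z1 g \<Longrightarrow>
      (\<And>u. u \<in> W2 \<Longrightarrow> f (\<iota> u) = g (\<iota> u)) \<Longrightarrow> x \<in> W1 \<Longrightarrow> f x = g x"
    and extend: "\<And>h. eigenfunction W2 F2 z2 h \<Longrightarrow>
      \<exists>f. eigenfunction W1 F1 z1 f \<and> (\<forall>u\<in>W2. f (\<iota> u) = h u)"
  shows "kernel_dim (char_matrix (map_mat of_real (nlap W1 F1)) z1) =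
    kernel_dim (char_matrix (map_mat of_real (nlap W2 F2)) z2)"
proof -
  have "bij_betw ((*\<^sub>v) (restrict_mat W1 W2 \<iota>))
      (mat_kernel (char_matrix (map_mat of_real (nlap W1 F1)) z1))
      (mat_kernel (char_matrix (map_mat of_real (nlap W2 F2)) z2))"
    using W1 W2 \<iota> restrict determined extend by (rule bij_betw_restrict_mat_eigenspaces)
  moreover have "char_matrix (map_mat of_real (nlap W1 F1)) z1 \<in> carrier_mat (card W1) (card W1)"
    and "char_matrix (map_mat of_real (nlap W2 F2)) z2 \<in> carrier_mat (card W2) (card W2)"
    using nlap_carrier_mat[OF W1] nlap_carrier_mat[OF W2] by simp_all
  ultimately show ?thesis
    by (intro kernel_dim_eq_if_bij_betw[OF _ _ restrict_mat_carrier])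
qed

lemma path_equations_solution:
  fixes \<mu> a b x y :: "'a::field_char_0"
  assumes "\<mu> * x = a + y / 2" and "\<mu> * y = b + x / 2" and "4 * \<mu>^2 \<noteq> 1"
  shows "x = (4 * \<mu> * a + 2 * b) / (4 * \<mu>^2 - 1)"
proof -
  have "x * (4 * \<mu>^2 - 1) = 4 * \<mu> * (\<mu> * x - y / 2) + 2 * (\<mu> * y - x / 2)"
    by (simp add: algebra_simps power2_eq_square)
  also have "\<dots> = 4 * \<mu> * a + 2 * b" using assms(1,2) by simp
  finally show ?thesis using assms(3) by (simp add: field_simps)
qed

lemma chebyshev_3_equation_iff:
  fixes \<mu> x s :: "'a::field"
  assumes "4 * \<mu>^2 \<noteq> 1"
  shows "\<mu> * x = (2 * \<mu> * x + s) / (4 * \<mu>^2 - 1) \<longleftrightarrow> (4 * \<mu>^3 - 3 * \<mu>) * x = s"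
proof -
  have "4 * \<mu>^2 - 1 \<noteq> 0" using assms by simp
  hence "\<mu> * x = (2 * \<mu> * x + s) / (4 * \<mu>^2 - 1) \<longleftrightarrow> \<mu> * x * (4 * \<mu>^2 - 1) = 2 * \<mu> * x + s"
    by (simp add: field_simps)
  also have "\<dots> \<longleftrightarrow> (4 * \<mu>^3 - 3 * \<mu>) * x = s"
    by (auto simp: algebra_simps power2_eq_square power3_eq_cube)
  finally show ?thesis .
qed

locale parallel_subdivision =
  fixes V :: "'a set" and E :: "'a set set" and k :: nat
  assumes simple: "simple_graph V E"
    and no_isolated: "no_isolated_vertices V E"
    and k_pos: "k \<ge> 1"
begin

abbreviation "VS \<equiv> subdiv_vertices V E k"
abbreviation "ES \<equiv> subdiv_edges V E k"

definition nbrs :: "'a \<Rightarrow> 'a set" where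
  "nbrs u = {v \<in> V. {u, v} \<in> E}"

lemma finite_V: "finite V"
  using simple unfolding simple_graph_def by auto

lemma edge_endpoints:
  assumes "{u, v} \<in> E"
  shows "u \<in> V" and "v \<in> V" and "u \<noteq> v"
proof -
  obtain a b where "{u, v} = {a, b}" "a \<noteq> b" "a \<in> V" "b \<in> V"
    using simple assms unfolding simple_graph_def by blast
  thus "u \<in> V" "v \<in> V" "u \<noteq> v" by (auto simp: doubleton_eq_iff)
qed

lemma edge_commute: "{u, v} \<in> E \<Longrightarrow> {v, u} \<in> E"
  by (simp add: insert_commute)

lemma loop_not_edge: "{u, u} \<notin> E"
  using edge_endpoints by blast

lemma nbrs_edge: "v \<in> nbrs u \<Longrightarrow> {u, v} \<in> E"
  unfolding nbrs_def by auto

lemma finite_nbrs: "finite (nbrs u)"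
  using finite_V unfolding nbrs_def by auto

lemma card_nbrs_pos:
  assumes "u \<in> V"
  shows "card (nbrs u) > 0"
proof -
  obtain e where "e \<in> E" "u \<in> e"
    using no_isolated assms unfolding no_isolated_vertices_def by blast
  then obtain v where "{u, v} \<in> E"
    using simple unfolding simple_graph_def by (metis edge_commute insertE singletonD)
  hence "v \<in> nbrs u" using edge_endpoints unfolding nbrs_def by blast
  thus ?thesis using finite_nbrs card_gt_0_iff by blast
qed

lemma finite_VS: "finite VS"
proof (rule finite_subset)
  show "VS \<subseteq> Inl ` V \<union> Inr ` (V \<times> V \<times> {..<k})"
    unfolding subdiv_vertices_def using edge_endpoints by auto
qed (simp add: finite_V)

lemma VS_cases:
  assumes "x \<in> VS"
  obtains (Inl) u where "u \<in> V" "x = Inl u"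
    | (Inr) u v i where "{u, v} \<in> E" "i < k" "x = Inr (u, v, i)"
  using assms unfolding subdiv_vertices_def by blast

lemma Inl_in_VS: "u \<in> V \<Longrightarrow> Inl u \<in> VS"
  unfolding subdiv_vertices_def by auto

lemma Inr_in_VS: "{u, v} \<in> E \<Longrightarrow> i < k \<Longrightarrow> Inr (u, v, i) \<in> VS"
  unfolding subdiv_vertices_def by auto

lemma loop_not_subdiv_edge: "{x, x} \<notin> ES"
  unfolding subdiv_edges_def using edge_endpoints loop_not_edge by (auto simp: doubleton_eq_iff)

lemma subdiv_nbrs_Inl:
  assumes "u \<in> V"
  shows "{y \<in> VS. {Inl u, y} \<in> ES} = (\<lambda>(v, i). Inr (u, v, i)) ` (nbrs u \<times> {..<k})"
proof
  show "{y \<in> VS. {Inl u, y} \<in> ES} \<subseteq> (\<lambda>(v, i). Inr (u, v, i)) ` (nbrs u \<times> {..<k})"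
    unfolding subdiv_edges_def nbrs_def using edge_endpoints by (auto simp: doubleton_eq_iff)
  show "(\<lambda>(v, i). Inr (u, v, i)) ` (nbrs u \<times> {..<k}) \<subseteq> {y \<in> VS. {Inl u, y} \<in> ES}"
    unfolding nbrs_def subdiv_edges_def using Inr_in_VS by auto
qed

lemma subdiv_nbrs_Inr:
  assumes "{u, v} \<in> E" and "i < k"
  shows "{y \<in> VS. {Inr (u, v, i), y} \<in> ES} = {Inl u, Inr (v, u, i)}"
proof
  show "{y \<in> VS. {Inr (u, v, i), y} \<in> ES} \<subseteq> {Inl u, Inr (v, u, i)}"
    unfolding subdiv_edges_def by (auto simp: doubleton_eq_iff)
  show "{Inl u, Inr (v, u, i)} \<subseteq> {y \<in> VS. {Inr (u, v, i), y} \<in> ES}"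
    using assms Inl_in_VS[OF edge_endpoints(1)[OF assms(1)]] Inr_in_VS[OF edge_commute[OF assms(1)]]
    unfolding subdiv_edges_def by (auto simp: insert_commute)
qed

lemma subdiv_degree_Inl:
  assumes "u \<in> V"
  shows "Defs.degree VS ES (Inl u) = card (nbrs u) * k"
proof -
  have inj: "inj_on (\<lambda>(v, i). Inr (u, v, i) :: 'a + 'a \<times> 'a \<times> nat) (nbrs u \<times> {..<k})"
    by (auto simp: inj_on_def)
  show ?thesis
    unfolding Defs.degree_def subdiv_nbrs_Inl[OF assms] card_image[OF inj]
    by (simp add: card_cartesian_product)
qed

lemma subdiv_degree_Inr: "{u, v} \<in> E \<Longrightarrow> i < k \<Longrightarrow> Defs.degree VS ES (Inr (u, v, i)) = 2"
  unfolding Defs.degree_def by (simp add: subdiv_nbrs_Inr)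

text \<open>The normalising factor \<open>sqrt (d(Inl u) d(Inr (u, v, i)))\<close> of the edges at an original vertex.\<close>
definition spoke :: "'a \<Rightarrow> complex" where
  "spoke u = of_real (sqrt (2 * real k * real (card (nbrs u))))"

lemma spoke_nonzero: "u \<in> V \<Longrightarrow> spoke u \<noteq> 0"
  using card_nbrs_pos k_pos by (simp add: spoke_def)

lemma spoke_mult_self: "spoke u * spoke u = 2 * of_nat k * of_nat (card (nbrs u))"
  unfolding spoke_def of_real_mult[symmetric] by simp

lemma spoke_mult:
  "spoke u * spoke v = 2 * of_nat k * of_real (sqrt (real (card (nbrs u)) * real (card (nbrs v))))"
proof -
  have "sqrt (2 * real k * real (card (nbrs u))) * sqrt (2 * real k * real (card (nbrs v))) =
      sqrt ((2 * real k) * (2 * real k)) * sqrt (real (card (nbrs u)) * real (card (nbrs v)))"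
    unfolding real_sqrt_mult[symmetric] by (simp add: ac_simps)
  also have "\<dots> = 2 * real k * sqrt (real (card (nbrs u)) * real (card (nbrs v)))"
    unfolding real_sqrt_abs2 by simp
  finally show ?thesis unfolding spoke_def of_real_mult[symmetric] by simp
qed

lemma nlap_row_Inl:
  fixes f :: "'a + 'a \<times> 'a \<times> nat \<Rightarrow> complex"
  assumes u: "u \<in> V"
  shows "(\<Sum>y\<in>VS. of_real (nlap_entry VS ES (Inl u) y) * f y) =
    f (Inl u) - (\<Sum>v\<in>nbrs u. \<Sum>i<k. f (Inr (u, v, i))) / spoke u"
proof -
  have inj: "inj_on (\<lambda>(v, i). Inr (u, v, i) :: 'a + 'a \<times> 'a \<times> nat) (nbrs u \<times> {..<k})"
    by (auto simp: inj_on_def)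
  have "(\<Sum>y\<in>VS. of_real (nlap_entry VS ES (Inl u) y) * f y) = f (Inl u) -
      (\<Sum>(v, i)\<in>nbrs u \<times> {..<k}. f (Inr (u, v, i)) / spoke u)"
    unfolding nlap_entry_sum[OF finite_VS Inl_in_VS[OF u] loop_not_subdiv_edge]
      subdiv_nbrs_Inl[OF u] sum.reindex[OF inj]
    by (intro arg_cong2[where f = minus] refl sum.cong)
      (auto simp: subdiv_degree_Inl[OF u] subdiv_degree_Inr[OF nbrs_edge] spoke_def ac_simps)
  thus ?thesis by (simp add: sum.cartesian_product sum_divide_distrib)
qed

lemma nlap_row_Inr:
  fixes f :: "'a + 'a \<times> 'a \<times> nat \<Rightarrow> complex"
  assumes e: "{u, v} \<in> E" and i: "i < k"
  shows "(\<Sum>y\<in>VS. of_real (nlap_entry VS ES (Inr (u, v, i)) y) * f y) =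
    f (Inr (u, v, i)) - (f (Inl u) / spoke u + f (Inr (v, u, i)) / 2)"
  unfolding nlap_entry_sum[OF finite_VS Inr_in_VS[OF e i] loop_not_subdiv_edge] subdiv_nbrs_Inr[OF e i]
  using subdiv_degree_Inr[OF e i] subdiv_degree_Inr[OF edge_commute[OF e] i]
    subdiv_degree_Inl[OF edge_endpoints(1)[OF e]]
  by (simp add: spoke_def ac_simps)

lemma nlap_row:
  fixes h :: "'a \<Rightarrow> complex"
  assumes u: "u \<in> V"
  shows "(\<Sum>y\<in>V. of_real (nlap_entry V E u y) * h y) =
    h u - (\<Sum>v\<in>nbrs u. h v / of_real (sqrt (real (card (nbrs u)) * real (card (nbrs v)))))"
  using nlap_entry_sum[OF finite_V u loop_not_edge] by (simp add: Defs.degree_def nbrs_def)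

lemma eigenfunction_subdiv_iff:
  "eigenfunction VS ES (1 - \<mu>) f \<longleftrightarrow>
    (\<forall>u\<in>V. \<mu> * f (Inl u) = (\<Sum>v\<in>nbrs u. \<Sum>i<k. f (Inr (u, v, i))) / spoke u) \<and>
    (\<forall>u v i. {u, v} \<in> E \<longrightarrow> i < k \<longrightarrow>
      \<mu> * f (Inr (u, v, i)) = f (Inl u) / spoke u + f (Inr (v, u, i)) / 2)"
proof -
  have row_iff: "a - b = (1 - \<mu>) * a \<longleftrightarrow> \<mu> * a = b" for a b
    by (auto simp: algebra_simps)
  have "eigenfunction VS ES (1 - \<mu>) f \<longleftrightarrow>
    (\<forall>u\<in>V. (\<Sum>y\<in>VS. of_real (nlap_entry VS ES (Inl u) y) * f y) = (1 - \<mu>) * f (Inl u)) \<and>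
    (\<forall>u v i. {u, v} \<in> E \<longrightarrow> i < k \<longrightarrow>
      (\<Sum>y\<in>VS. of_real (nlap_entry VS ES (Inr (u, v, i)) y) * f y) = (1 - \<mu>) * f (Inr (u, v, i)))"
    unfolding eigenfunction_def by (blast elim: VS_cases intro: Inl_in_VS Inr_in_VS)
  moreover have "(\<Sum>y\<in>VS. of_real (nlap_entry VS ES (Inl u) y) * f y) = (1 - \<mu>) * f (Inl u) \<longleftrightarrow>
      \<mu> * f (Inl u) = (\<Sum>v\<in>nbrs u. \<Sum>i<k. f (Inr (u, v, i))) / spoke u" if "u \<in> V" for u
    unfolding nlap_row_Inl[OF that] by (rule row_iff)
  moreover have "(\<Sum>y\<in>VS. of_real (nlap_entry VS ES (Inr (u, v, i)) y) * f y) = (1 - \<mu>) * f (Inr (u, v, i))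
      \<longleftrightarrow> \<mu> * f (Inr (u, v, i)) = f (Inl u) / spoke u + f (Inr (v, u, i)) / 2"
    if "{u, v} \<in> E" "i < k" for u v i
    unfolding nlap_row_Inr[OF that] by (rule row_iff)
  ultimately show ?thesis by blast
qed

lemma eigenfunction_graph_iff:
  "eigenfunction V E (1 - \<mu>) h \<longleftrightarrow>
    (\<forall>u\<in>V. \<mu> * h u = (\<Sum>v\<in>nbrs u. h v / of_real (sqrt (real (card (nbrs u)) * real (card (nbrs v))))))"
  unfolding eigenfunction_def
proof (intro ball_cong refl)
  fix u assume "u \<in> V"
  show "(\<Sum>y\<in>V. of_real (nlap_entry V E u y) * h y) = (1 - \<mu>) * h u \<longleftrightarrow>
    \<mu> * h u = (\<Sum>v\<in>nbrs u. h v / of_real (sqrt (real (card (nbrs u)) * real (card (nbrs v)))))"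
    unfolding nlap_row[OF \<open>u \<in> V\<close>] by (auto simp: algebra_simps)
qed


text \<open>On the path \<open>Inl u, Inr (u, v, i), Inr (v, u, i), Inl v\<close> the two eigenvalue equations at the
  inner vertices determine the values there from those at the ends.\<close>
definition lift :: "complex \<Rightarrow> ('a \<Rightarrow> complex) \<Rightarrow> 'a + 'a \<times> 'a \<times> nat \<Rightarrow> complex" where
  "lift \<mu> h x = (case x of
     Inl u \<Rightarrow> h u
   | Inr (u, v, _) \<Rightarrow> (4 * \<mu> * (h u / spoke u) + 2 * (h v / spoke v)) / (4 * \<mu>^2 - 1))"

lemma lift_Inl [simp]: "lift \<mu> h (Inl u) = h u"
  by (simp add: lift_def)

lemma lift_Inr [simp]:
  "lift \<mu> h (Inr (u, v, i)) = (4 * \<mu> * (h u / spoke u) + 2 * (h v / spoke v)) / (4 * \<mu>^2 - 1)"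
  by (simp add: lift_def)

lemma lift_cong:
  assumes "\<And>u. u \<in> V \<Longrightarrow> h u = h' u" and "x \<in> VS"
  shows "lift \<mu> h x = lift \<mu> h' x"
  using assms(2)
proof (cases rule: VS_cases)
  case (Inr u v i)
  thus ?thesis using assms(1) edge_endpoints[OF Inr(1)] by simp
qed (use assms(1) in simp)

context
  fixes \<mu> :: complex
  assumes \<mu>: "4 * \<mu>^2 \<noteq> 1"
begin

lemma eigenfunction_subdiv_eq_lift:
  assumes eig: "eigenfunction VS ES (1 - \<mu>) f" and x: "x \<in> VS"
  shows "f x = lift \<mu> (f \<circ> Inl) x"
  using x
proof (cases rule: VS_cases)
  case (Inr u v i)
  have "\<mu> * f (Inr (u, v, i)) = f (Inl u) / spoke u + f (Inr (v, u, i)) / 2"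
    and "\<mu> * f (Inr (v, u, i)) = f (Inl v) / spoke v + f (Inr (u, v, i)) / 2"
    using eig Inr(1,2) edge_commute[OF Inr(1)] unfolding eigenfunction_subdiv_iff by blast+
  from path_equations_solution[OF this \<mu>] show ?thesis using Inr(3) by simp
qed simp

lemma sum_lift_paths:
  assumes u: "u \<in> V"
  shows "(\<Sum>v\<in>nbrs u. \<Sum>i<k. lift \<mu> h (Inr (u, v, i))) / spoke u =
    (2 * \<mu> * h u + (\<Sum>v\<in>nbrs u. h v / of_real (sqrt (real (card (nbrs u)) * real (card (nbrs v))))))
      / (4 * \<mu>^2 - 1)"
proof -
  let ?D = "4 * \<mu>^2 - 1"
  let ?sq = "\<lambda>v. complex_of_real (sqrt (real (card (nbrs u)) * real (card (nbrs v))))"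
  have D: "?D \<noteq> 0" using \<mu> by simp
  have d: "of_nat (card (nbrs u)) \<noteq> (0 :: complex)" using card_nbrs_pos[OF u] by simp
  have path: "of_nat k * ((4 * \<mu> * (h u / spoke u) + 2 * (h v / spoke v)) / ?D) / spoke u =
      (2 * \<mu> * h u / of_nat (card (nbrs u)) + h v / ?sq v) / ?D" if v: "v \<in> nbrs u" for v
  proof -
    have "?sq v \<noteq> 0"
      using card_nbrs_pos[OF u] card_nbrs_pos[OF edge_endpoints(2)[OF nbrs_edge[OF v]]] by simp
    hence "of_nat k * ((4 * \<mu> * (h u / spoke u) + 2 * (h v / spoke v)) / ?D) / spoke u =
        (4 * \<mu> * of_nat k * h u / (spoke u * spoke u) + 2 * of_nat k * h v / (spoke u * spoke v)) / ?D"
      using spoke_nonzero[OF u] spoke_nonzero[OF edge_endpoints(2)[OF nbrs_edge[OF v]]] D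
      by (simp add: field_simps)
    also have "\<dots> = (2 * \<mu> * h u / of_nat (card (nbrs u)) + h v / ?sq v) / ?D"
      unfolding spoke_mult_self spoke_mult using k_pos d by (simp add: field_simps)
    finally show ?thesis .
  qed
  have "(\<Sum>v\<in>nbrs u. \<Sum>i<k. lift \<mu> h (Inr (u, v, i))) / spoke u =
      (\<Sum>v\<in>nbrs u. of_nat k * ((4 * \<mu> * (h u / spoke u) + 2 * (h v / spoke v)) / ?D) / spoke u)"
    by (simp add: sum_divide_distrib)
  also have "\<dots> = (\<Sum>v\<in>nbrs u. (2 * \<mu> * h u / of_nat (card (nbrs u)) + h v / ?sq v) / ?D)"
    using path by (rule sum.cong[OF refl])
  also have "\<dots> = (2 * \<mu> * h u + (\<Sum>v\<in>nbrs u. h v / ?sq v)) / ?D"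
    using d by (simp add: sum.distrib sum_divide_distrib[symmetric])
  finally show ?thesis .
qed

lemma eigenfunction_restrict:
  assumes eig: "eigenfunction VS ES (1 - \<mu>) f"
  shows "eigenfunction V E (1 - (4 * \<mu>^3 - 3 * \<mu>)) (f \<circ> Inl)"
  unfolding eigenfunction_graph_iff
proof
  fix u assume u: "u \<in> V"
  have "\<mu> * f (Inl u) = (\<Sum>v\<in>nbrs u. \<Sum>i<k. f (Inr (u, v, i))) / spoke u"
    using eig u unfolding eigenfunction_subdiv_iff by blast
  also have "\<dots> = (\<Sum>v\<in>nbrs u. \<Sum>i<k. lift \<mu> (f \<circ> Inl) (Inr (u, v, i))) / spoke u"
    using eigenfunction_subdiv_eq_lift[OF eig] Inr_in_VS nbrs_edge by simp
  also have "\<dots> = (2 * \<mu> * f (Inl u) + (\<Sum>v\<in>nbrs u. (f \<circ> Inl) v /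
      of_real (sqrt (real (card (nbrs u)) * real (card (nbrs v)))))) / (4 * \<mu>^2 - 1)"
    unfolding sum_lift_paths[OF u] by simp
  finally show "(4 * \<mu>^3 - 3 * \<mu>) * (f \<circ> Inl) u = (\<Sum>v\<in>nbrs u. (f \<circ> Inl) v /
      of_real (sqrt (real (card (nbrs u)) * real (card (nbrs v)))))"
    using chebyshev_3_equation_iff[OF \<mu>] by simp
qed

lemma eigenfunction_lift:
  assumes eig: "eigenfunction V E (1 - (4 * \<mu>^3 - 3 * \<mu>)) h"
  shows "eigenfunction VS ES (1 - \<mu>) (lift \<mu> h)"
  unfolding eigenfunction_subdiv_iff
proof (intro conjI ballI allI impI)
  fix u assume u: "u \<in> V"
  have "(4 * \<mu>^3 - 3 * \<mu>) * h u =
      (\<Sum>v\<in>nbrs u. h v / of_real (sqrt (real (card (nbrs u)) * real (card (nbrs v)))))"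
    using eig u unfolding eigenfunction_graph_iff by blast
  thus "\<mu> * lift \<mu> h (Inl u) = (\<Sum>v\<in>nbrs u. \<Sum>i<k. lift \<mu> h (Inr (u, v, i))) / spoke u"
    unfolding sum_lift_paths[OF u] lift_Inl chebyshev_3_equation_iff[OF \<mu>] .
next
  fix u v i
  have "4 * \<mu>^2 - 1 \<noteq> 0" using \<mu> by simp
  hence "\<mu> * ((4 * \<mu> * a + 2 * b) / (4 * \<mu>^2 - 1)) = a + (4 * \<mu> * b + 2 * a) / (4 * \<mu>^2 - 1) / 2"
    for a b :: complex
    by (simp add: field_simps power2_eq_square)
  from this[of "h u / spoke u" "h v / spoke v"]
  show "\<mu> * lift \<mu> h (Inr (u, v, i)) = lift \<mu> h (Inl u) / spoke u + lift \<mu> h (Inr (v, u, i)) / 2"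
    by (simp add: add.commute)
qed

lemma kernel_dim_subdiv_eq:
  "kernel_dim (char_matrix (map_mat of_real (nlap VS ES)) (1 - \<mu>)) =
    kernel_dim (char_matrix (map_mat of_real (nlap V E)) (1 - (4 * \<mu>^3 - 3 * \<mu>)))"
proof (rule kernel_dim_nlap_eq_if_eigenfunctions_correspond[where \<iota> = Inl, OF finite_VS finite_V])
  show "Inl ` V \<subseteq> VS" using Inl_in_VS by blast
  show "eigenfunction V E (1 - (4 * \<mu>^3 - 3 * \<mu>)) (f \<circ> Inl)"
    if "eigenfunction VS ES (1 - \<mu>) f" for f
    using eigenfunction_restrict[OF that] .
  show "f x = g x" if f: "eigenfunction VS ES (1 - \<mu>) f" and g: "eigenfunction VS ES (1 - \<mu>) g"
    and fg: "\<And>u. u \<in> V \<Longrightarrow> f (Inl u) = g (Inl u)" and x: "x \<in> VS" for f g x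
  proof -
    have "f x = lift \<mu> (f \<circ> Inl) x" by (rule eigenfunction_subdiv_eq_lift[OF f x])
    also have "\<dots> = lift \<mu> (g \<circ> Inl) x" using fg by (intro lift_cong[OF _ x]) simp
    also have "\<dots> = g x" by (rule eigenfunction_subdiv_eq_lift[OF g x, symmetric])
    finally show ?thesis .
  qed
  show "\<exists>f. eigenfunction VS ES (1 - \<mu>) f \<and> (\<forall>u\<in>V. f (Inl u) = h u)"
    if "eigenfunction V E (1 - (4 * \<mu>^3 - 3 * \<mu>)) h" for h
    using eigenfunction_lift[OF that] by auto
qed

end

end

theorem lemma3p2:
  fixes V :: "'a set" and E :: "'a set set" and k :: nat and \<zeta> :: real
  assumes "simple_graph V E" and "connected_graph V E" and "no_isolated_vertices V E"
    and "k \<ge> 1"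
    and "\<zeta> \<notin> {1/2, 3/2}"
    and "eigenvalue (nlap (subdiv_vertices V E k) (subdiv_edges V E k)) \<zeta>"
  shows "eigenvalue (nlap V E) (\<zeta> * (4 * \<zeta>^2 - 12 * \<zeta> + 9))
    \<and> order (\<zeta> * (4 * \<zeta>^2 - 12 * \<zeta> + 9)) (char_poly (nlap V E))
      = order \<zeta> (char_poly (nlap (subdiv_vertices V E k) (subdiv_edges V E k)))"
proof -
  interpret parallel_subdivision V E k using assms by unfold_locales
  define \<mu> where "\<mu> = complex_of_real (1 - \<zeta>)"
  have \<mu>: "4 * \<mu>^2 \<noteq> 1"
  proof
    assume "4 * \<mu>^2 = 1"
    moreover have "4 * \<mu>^2 = of_real (4 * (1 - \<zeta>)^2)" unfolding \<mu>_def by simp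
    ultimately have "4 * (1 - \<zeta>)^2 = 1" by (metis of_real_eq_1_iff)
    hence "(2 * \<zeta> - 1) * (2 * \<zeta> - 3) = 0" by (simp add: algebra_simps power2_eq_square)
    thus False using assms(5) by auto
  qed
  have \<zeta>: "of_real \<zeta> = 1 - \<mu>"
    and \<zeta>': "of_real (\<zeta> * (4 * \<zeta>^2 - 12 * \<zeta> + 9)) = 1 - (4 * \<mu>^3 - 3 * \<mu>)"
    unfolding \<mu>_def by (simp_all add: algebra_simps power2_eq_square power3_eq_cube)
  have orders: "order (\<zeta> * (4 * \<zeta>^2 - 12 * \<zeta> + 9)) (char_poly (nlap V E)) =
      order \<zeta> (char_poly (nlap VS ES))"
    unfolding order_char_poly_nlap[OF finite_V] order_char_poly_nlap[OF finite_VS] \<zeta> \<zeta>'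
    by (rule kernel_dim_subdiv_eq[OF \<mu>, symmetric])
  moreover have "eigenvalue (nlap V E) (\<zeta> * (4 * \<zeta>^2 - 12 * \<zeta> + 9))"
    using assms(6) orders
    unfolding eigenvalue_iff_order_char_poly[OF nlap_carrier_mat[OF finite_V]]
      eigenvalue_iff_order_char_poly[OF nlap_carrier_mat[OF finite_VS]]
    by simp
  ultimately show ?thesis by blast
qed

end
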